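(* Let $\Omega$ be a nonempty convex subset of a normed vector space, and let $\{f_\alpha\}_{\alpha\in I}$ be a nonempty collection of functions from $\Omega$ to $[-\infty,\infty]$ such that $f_\alpha$ is $\sigma_\alpha$-quasiconvex, where $\sigma_\alpha\ge 0$, for all $\alpha\in I$. Let $\sigma=\inf_{\alpha\in I}\sigma_\alpha$. Then $f=\sup_{\alpha\in I}f_\alpha$ (pointwise supremum) is $\sigma$-quasiconvex. In particular, $f$ is strongly quasiconvex if $\sigma>0$.
   Context: All normed vector spaces are real and nontrivial. Let $\sigma\ge 0$. A function $f\colon\Omega\to[-\infty,\infty]$ on a nonempty convex set $\Omega$ is $\sigma$-quasiconvex if $f(\lambda x+(1-\lambda)y)\le\max\{f(x),f(y)\}-\frac{\sigma}{2}\lambda(1-\lambda)\|x-y\|^2$ for all $x,y\in\Omega$ and $0<\lambda<1$. It is strongly quasiconvex if this holds for some $\sigma>0$. *)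

theory Defs
  imports "HOL-Analysis.Convex" "HOL-Library.Extended_Real"
begin

text \<open>
  As with \<^const>\<open>convex_on\<close>, a function on \<open>\<Omega>\<close> is represented by a total function of which only
  the values on \<open>\<Omega>\<close> matter, and convexity of the domain is part of the predicate.
  The subtracted term is a finite real, so the difference of extended reals below is never
  of the form \<open>\<infinity> - \<infinity>\<close>.
\<close>

definition quasiconvex_with :: "real \<Rightarrow> 'a::real_normed_vector set \<Rightarrow> ('a \<Rightarrow> ereal) \<Rightarrow> bool"
  where "quasiconvex_with \<sigma> \<Omega> f \<longleftrightarrow>
    0 \<le> \<sigma> \<and> \<Omega> \<noteq> {} \<and> convex \<Omega> \<and>
    (\<forall>x\<in>\<Omega>. \<forall>y\<in>\<Omega>. \<forall>t::real. 0 < t \<and> t < 1 \<longrightarrow>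
      f (t *\<^sub>R x + (1 - t) *\<^sub>R y)
        \<le> max (f x) (f y) - ereal (\<sigma> / 2 * t * (1 - t) * (norm (x - y))\<^sup>2))"

definition strongly_quasiconvex :: "'a::real_normed_vector set \<Rightarrow> ('a \<Rightarrow> ereal) \<Rightarrow> bool"
  where "strongly_quasiconvex \<Omega> f \<longleftrightarrow> (\<exists>\<sigma>>0. quasiconvex_with \<sigma> \<Omega> f)"

end

theory Submission imports Defs begin

text \<open>The subtracted term grows with the modulus, so a function keeps its inequality when the
  modulus is lowered (\<open>quasiconvex_with_antimono\<close>). Hence all members of the family
  share the infimum as a modulus. Once the modulus is common, the subtracted term no longer depends
  on the index, and the inequality passes to the pointwise supremum because \<open>max\<close> is
  monotone (\<open>quasiconvex_with_SUP\<close>).\<close>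

lemma quasiconvex_with_antimono:
  assumes f: "quasiconvex_with \<tau> \<Omega> f" and "0 \<le> \<sigma>" and "\<sigma> \<le> \<tau>"
  shows "quasiconvex_with \<sigma> \<Omega> f"
  unfolding quasiconvex_with_def
proof (intro conjI ballI allI impI)
  fix x y and t :: real
  assume xy: "x \<in> \<Omega>" "y \<in> \<Omega>" and t: "0 < t \<and> t < 1"
  have "f (t *\<^sub>R x + (1 - t) *\<^sub>R y)
      \<le> max (f x) (f y) - ereal (\<tau> / 2 * t * (1 - t) * (norm (x - y))\<^sup>2)"
    using f xy t unfolding quasiconvex_with_def by blast
  also have "\<dots> \<le> max (f x) (f y) - ereal (\<sigma> / 2 * t * (1 - t) * (norm (x - y))\<^sup>2)"
    \<comment> \<open>For 0 < t < 1 the factor multiplying the modulus is nonnegative, so the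
      smaller modulus subtracts no more.\<close>
    using t \<open>\<sigma> \<le> \<tau>\<close> by (intro ereal_minus_mono order_refl) (simp add: mult_right_mono)
  finally show "f (t *\<^sub>R x + (1 - t) *\<^sub>R y)
      \<le> max (f x) (f y) - ereal (\<sigma> / 2 * t * (1 - t) * (norm (x - y))\<^sup>2)" .
qed (use assms in \<open>auto simp: quasiconvex_with_def\<close>)

lemma quasiconvex_with_SUP:
  assumes "I \<noteq> {}" and f: "\<And>\<alpha>. \<alpha> \<in> I \<Longrightarrow> quasiconvex_with \<sigma> \<Omega> (f \<alpha>)"
  shows "quasiconvex_with \<sigma> \<Omega> (\<lambda>x. SUP \<alpha>\<in>I. f \<alpha> x)"
  unfolding quasiconvex_with_def
proof (intro conjI ballI allI impI)
  fix x y and t :: real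
  assume xy: "x \<in> \<Omega>" "y \<in> \<Omega>" and t: "0 < t \<and> t < 1"
  let ?c = "ereal (\<sigma> / 2 * t * (1 - t) * (norm (x - y))\<^sup>2)"
  show "(SUP \<alpha>\<in>I. f \<alpha> (t *\<^sub>R x + (1 - t) *\<^sub>R y))
      \<le> max (SUP \<alpha>\<in>I. f \<alpha> x) (SUP \<alpha>\<in>I. f \<alpha> y) - ?c"
  proof (rule SUP_least)
    fix \<alpha> assume \<alpha>: "\<alpha> \<in> I"
    have "f \<alpha> (t *\<^sub>R x + (1 - t) *\<^sub>R y) \<le> max (f \<alpha> x) (f \<alpha> y) - ?c"
      using f[OF \<alpha>] xy t unfolding quasiconvex_with_def by blast
    \<comment> \<open>\<open>?c\<close> is the same for every index, so only the two values under
      \<open>max\<close> are enlarged. The resulting bound is free of \<open>\<alpha>\<close>, as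
      \<open>SUP_least\<close> requires.\<close>
    also have "\<dots> \<le> max (SUP \<alpha>\<in>I. f \<alpha> x) (SUP \<alpha>\<in>I. f \<alpha> y) - ?c"
      using \<alpha> by (intro ereal_minus_mono max.mono SUP_upper order_refl)
    finally show "f \<alpha> (t *\<^sub>R x + (1 - t) *\<^sub>R y)
        \<le> max (SUP \<alpha>\<in>I. f \<alpha> x) (SUP \<alpha>\<in>I. f \<alpha> y) - ?c" .
  qed
\<comment> \<open>The conditions on \<open>\<sigma>\<close> and \<open>\<Omega>\<close> are read off
  from any one member of the family, which exists since \<open>I\<close> is nonempty.\<close>
qed (use assms in \<open>auto simp: quasiconvex_with_def\<close>)

theorem proposition2p3:
  fixes \<Omega> :: "'a::real_normed_vector set"
    and I :: "'i set"
    and f :: "'i \<Rightarrow> 'a \<Rightarrow> ereal"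
    and \<sigma> :: "'i \<Rightarrow> real"
  assumes "\<exists>v::'a. v \<noteq> 0"
    and "\<Omega> \<noteq> {}" and "convex \<Omega>"
    and "I \<noteq> {}"
    and "\<And>\<alpha>. \<alpha> \<in> I \<Longrightarrow> 0 \<le> \<sigma> \<alpha>"
    and "\<And>\<alpha>. \<alpha> \<in> I \<Longrightarrow> quasiconvex_with (\<sigma> \<alpha>) \<Omega> (f \<alpha>)"
  shows "quasiconvex_with (INF \<alpha>\<in>I. \<sigma> \<alpha>) \<Omega> (\<lambda>x. SUP \<alpha>\<in>I. f \<alpha> x) \<and>
    ((INF \<alpha>\<in>I. \<sigma> \<alpha>) > 0 \<longrightarrow> strongly_quasiconvex \<Omega> (\<lambda>x. SUP \<alpha>\<in>I. f \<alpha> x))"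
proof -
  \<comment> \<open>The reals are only conditionally complete: nonemptiness of \<open>I\<close> is
    needed here, and the lower bound 0 is needed for the next fact.\<close>
  have "0 \<le> (INF \<alpha>\<in>I. \<sigma> \<alpha>)"
    using assms(4,5) by (rule cINF_greatest)
  moreover have "(INF \<alpha>\<in>I. \<sigma> \<alpha>) \<le> \<sigma> \<alpha>" if "\<alpha> \<in> I" for \<alpha>
    using assms(5) that by (intro cINF_lower bdd_belowI2)
  ultimately have "quasiconvex_with (INF \<alpha>\<in>I. \<sigma> \<alpha>) \<Omega> (\<lambda>x. SUP \<alpha>\<in>I. f \<alpha> x)"
    using assms(4,6) by (blast intro: quasiconvex_with_SUP quasiconvex_with_antimono)
  \<comment> \<open>When positive, the infimum itself witnesses strong quasiconvexity.\<close>
  then show ?thesis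
    unfolding strongly_quasiconvex_def by blast
qed

end
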